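(* Let $R$ be a commutative ring and $M$ a nonzero second representable $R$-module. Let $\sum_{i=1}^nK_i=M=\sum_{i=1}^nN_i$ be two minimal second representations of $M$ such that $K_i$ and $N_i$ are $p_i$-second submodules of $M$ for each $i\in\{1,\dots,n\}$. If $j\in\{1,\dots,n\}$ is such that $p_j$ is minimal (with respect to inclusion) in $\{p_1,\dots,p_n\}$, then $K_j=N_j$.
   Context: Let $R$ be a commutative ring and $M$ a nonzero $R$-module. A submodule $K\le M$ is called second if $K\neq 0$ and for every ideal $I\le R$ we have $IK=K$ or $IK=0$. If $K$ is second, then $p:=(0:_RK)=\{r\in R\mid rK=0\}$ is a prime ideal and $K$ is called $p$-second. $M$ is called second representable if it has a second representation, i.e. an expression $M=\sum_{i=1}^nK_i$ as a finite sum of second submodules. A second representation is called minimal if (1) $(0:_RK_i)\neq(0:_RK_j)$ for $i\neq j$, and (2) $K_j\nsubseteq\sum_{i\neq j}K_i$ for all $j=1,\dots,n$. *)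

theory Defs
  imports "HOL-Algebra.Algebra"
begin

text \<open>
  The product \<open>I K\<close> of an ideal of \<open>R\<close> and a submodule of \<open>M\<close>: all finite sums of elements
  \<open>a x\<close> with \<open>a\<close> in \<open>I\<close> and \<open>x\<close> in \<open>K\<close>, by the same inductive scheme as \<^const>\<open>ideal_prod\<close>.
  The empty sum needs no rule of its own, since an ideal and a submodule both contain zero.
\<close>

inductive_set ideal_smult ::
    "('b, 'a, 'm) module_scheme \<Rightarrow> 'b set \<Rightarrow> 'a set \<Rightarrow> 'a set"
  for M and I and K where
    smult: "\<lbrakk> a \<in> I; x \<in> K \<rbrakk> \<Longrightarrow> a \<odot>\<^bsub>M\<^esub> x \<in> ideal_smult M I K"
  | sum: "\<lbrakk> x \<in> ideal_smult M I K; y \<in> ideal_smult M I K \<rbrakk>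
      \<Longrightarrow> x \<oplus>\<^bsub>M\<^esub> y \<in> ideal_smult M I K"

definition annihilator ::
    "('b, 'r) ring_scheme \<Rightarrow> ('b, 'a, 'm) module_scheme \<Rightarrow> 'a set \<Rightarrow> 'b set"
  where "annihilator R M K = {r \<in> carrier R. \<forall>x\<in>K. r \<odot>\<^bsub>M\<^esub> x = \<zero>\<^bsub>M\<^esub>}"

definition submodule_sum ::
    "('b, 'a, 'm) module_scheme \<Rightarrow> 'i set \<Rightarrow> ('i \<Rightarrow> 'a set) \<Rightarrow> 'a set"
  where "submodule_sum M I K = {\<Oplus>\<^bsub>M\<^esub>i\<in>I. x i | x. x \<in> (\<Pi> i\<in>I. K i)}"

definition second_submodule ::
    "('b, 'r) ring_scheme \<Rightarrow> ('b, 'a, 'm) module_scheme \<Rightarrow> 'a set \<Rightarrow> bool"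
  where "second_submodule R M K \<longleftrightarrow>
    submodule K R M \<and> K \<noteq> {\<zero>\<^bsub>M\<^esub>} \<and>
    (\<forall>I. ideal I R \<longrightarrow> ideal_smult M I K = K \<or> ideal_smult M I K = {\<zero>\<^bsub>M\<^esub>})"

text \<open>
  That \<open>p\<close> is prime is not part of the following definition: it is automatic, as
  \<open>second_imp_primeideal\<close> below shows.
\<close>

definition p_second ::
    "('b, 'r) ring_scheme \<Rightarrow> ('b, 'a, 'm) module_scheme \<Rightarrow> 'b set \<Rightarrow> 'a set \<Rightarrow> bool"
  where "p_second R M p K \<longleftrightarrow> second_submodule R M K \<and> p = annihilator R M K"

definition second_representation ::
    "('b, 'r) ring_scheme \<Rightarrow> ('b, 'a, 'm) module_scheme \<Rightarrow> nat \<Rightarrow> (nat \<Rightarrow> 'a set) \<Rightarrow> bool"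
  where "second_representation R M n K \<longleftrightarrow>
    (\<forall>i\<in>{1..n}. second_submodule R M (K i)) \<and> carrier M = submodule_sum M {1..n} K"

definition second_representable ::
    "('b, 'r) ring_scheme \<Rightarrow> ('b, 'a, 'm) module_scheme \<Rightarrow> bool"
  where "second_representable R M \<longleftrightarrow> (\<exists>n K. second_representation R M n K)"

definition minimal_second_representation ::
    "('b, 'r) ring_scheme \<Rightarrow> ('b, 'a, 'm) module_scheme \<Rightarrow> nat \<Rightarrow> (nat \<Rightarrow> 'a set) \<Rightarrow> bool"
  where "minimal_second_representation R M n K \<longleftrightarrow>
    second_representation R M n K \<and>
    (\<forall>i\<in>{1..n}. \<forall>j\<in>{1..n}. i \<noteq> j \<longrightarrow> annihilator R M (K i) \<noteq> annihilator R M (K j)) \<and>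
    (\<forall>j\<in>{1..n}. \<not> K j \<subseteq> submodule_sum M ({1..n} - {j}) K)"

lemma (in module) annihilator_ideal:
  assumes "submodule K R M"
  shows "ideal (annihilator R M K) R"
proof -
  have K: "K \<subseteq> carrier M" by (rule submoduleE(1)[OF assms])
  show ?thesis
  proof (rule idealI)
    show "ring R" by (rule R.ring_axioms)
    show "subgroup (annihilator R M K) (add_monoid R)"
    proof (rule R.add.subgroupI)
      show "annihilator R M K \<subseteq> carrier R" by (auto simp: annihilator_def)
      show "annihilator R M K \<noteq> {}"
        using K by (auto simp: annihilator_def intro!: exI[of _ "\<zero>\<^bsub>R\<^esub>"])
      show "\<ominus>\<^bsub>R\<^esub> a \<in> annihilator R M K" if "a \<in> annihilator R M K" for a
        using that K by (auto simp: annihilator_def smult_l_minus subset_iff)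
      show "a \<oplus>\<^bsub>R\<^esub> b \<in> annihilator R M K"
        if "a \<in> annihilator R M K" "b \<in> annihilator R M K" for a b
        using that K by (auto simp: annihilator_def smult_l_distr subset_iff)
    qed
    show "x \<otimes>\<^bsub>R\<^esub> a \<in> annihilator R M K"
      if "a \<in> annihilator R M K" "x \<in> carrier R" for a x
      using that K by (auto simp: annihilator_def smult_assoc1 subset_iff)
    then show "a \<otimes>\<^bsub>R\<^esub> x \<in> annihilator R M K"
      if "a \<in> annihilator R M K" "x \<in> carrier R" for a x
      using that R.m_comm by (auto simp: annihilator_def)
  qed
qed

lemma (in module) second_imp_primeideal:
  assumes "second_submodule R M K"
  shows "primeideal (annihilator R M K) R"
proof (rule primeidealI)
  have sub: "submodule K R M" and nz: "K \<noteq> {\<zero>\<^bsub>M\<^esub>}"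
    and sec: "\<And>I. ideal I R \<Longrightarrow> ideal_smult M I K = K \<or> ideal_smult M I K = {\<zero>\<^bsub>M\<^esub>}"
    using assms by (auto simp: second_submodule_def)
  have K: "K \<subseteq> carrier M" and ne: "K \<noteq> {}" using submoduleE[OF sub] by auto
  show "ideal (annihilator R M K) R" by (rule annihilator_ideal[OF sub])
  show "cring R" by (rule R.is_cring)
  show "carrier R \<noteq> annihilator R M K"
  proof
    assume "carrier R = annihilator R M K"
    then have "\<one>\<^bsub>R\<^esub> \<in> annihilator R M K" by (metis R.one_closed)
    then have "\<forall>x\<in>K. x = \<zero>\<^bsub>M\<^esub>" using K by (auto simp: annihilator_def subset_iff)
    then show False using nz ne by auto
  qed
  fix a b assume a: "a \<in> carrier R" and b: "b \<in> carrier R"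
    and ab: "a \<otimes>\<^bsub>R\<^esub> b \<in> annihilator R M K"
  let ?I = "PIdl\<^bsub>R\<^esub> a"
  have I: "ideal ?I R" by (rule R.cgenideal_ideal[OF a])
  consider "ideal_smult M ?I K = K" | "ideal_smult M ?I K = {\<zero>\<^bsub>M\<^esub>}" using sec[OF I] by auto
  then show "a \<in> annihilator R M K \<or> b \<in> annihilator R M K"
  proof cases
    case 1
    have "y \<in> carrier M \<and> b \<odot>\<^bsub>M\<^esub> y = \<zero>\<^bsub>M\<^esub>" if "y \<in> ideal_smult M ?I K" for y
      using that
    proof induction
      case (smult c x)
      then obtain r where r: "r \<in> carrier R" "c = r \<otimes>\<^bsub>R\<^esub> a" by (auto simp: cgenideal_def)
      have x: "x \<in> carrier M" using smult K by auto
      have "b \<odot>\<^bsub>M\<^esub> (c \<odot>\<^bsub>M\<^esub> x) = (b \<otimes>\<^bsub>R\<^esub> (r \<otimes>\<^bsub>R\<^esub> a)) \<odot>\<^bsub>M\<^esub> x"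
        using r a b x by (simp add: smult_assoc1)
      also have "b \<otimes>\<^bsub>R\<^esub> (r \<otimes>\<^bsub>R\<^esub> a) = r \<otimes>\<^bsub>R\<^esub> (a \<otimes>\<^bsub>R\<^esub> b)"
        using r a b by (simp add: R.m_ac)
      also have "\<dots> \<odot>\<^bsub>M\<^esub> x = r \<odot>\<^bsub>M\<^esub> ((a \<otimes>\<^bsub>R\<^esub> b) \<odot>\<^bsub>M\<^esub> x)"
        using r a b x by (intro smult_assoc1) auto
      also have "(a \<otimes>\<^bsub>R\<^esub> b) \<odot>\<^bsub>M\<^esub> x = \<zero>\<^bsub>M\<^esub>"
        using ab smult by (auto simp: annihilator_def)
      finally show ?case using r a x by simp
    next
      case (sum x y)
      then show ?case using b by (simp add: smult_r_distr)
    qed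
    then show ?thesis using 1 b by (auto simp: annihilator_def)
  next
    case 2
    have "a \<odot>\<^bsub>M\<^esub> x = \<zero>\<^bsub>M\<^esub>" if "x \<in> K" for x
      using ideal_smult.smult[OF R.cgenideal_self[OF a] that, of M] 2 by auto
    then show ?thesis using a by (auto simp: annihilator_def)
  qed
qed

end

theory Submission
  imports Defs
begin

text \<open>
  Minimality of \<open>p j\<close>, together with distinctness of the primes of a minimal representation, says
  that no \<open>p i\<close> with \<open>i \<noteq> j\<close> lies in \<open>p j\<close>. As \<open>p j\<close> is prime, one can multiply elements of
  \<open>p i - p j\<close> to obtain a single \<open>a\<close> that lies in every other \<open>p i\<close> but not in \<open>p j\<close>
  (\<open>exists_in_ideals_notin_prime\<close>). Multiplication by \<open>a\<close> kills every second summand other than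
  the \<open>j\<close>-th one, and it maps the \<open>j\<close>-th one onto itself (\<open>second_smult_image\<close>). Hence the \<open>j\<close>-th
  summand equals \<open>a M\<close> (\<open>second_summand_eq_smult_image\<close>), a submodule that depends on the primes
  alone and not on the summands; so it is the same for both representations.
\<close>

lemma exists_in_ideals_notin_prime:
  assumes P: "primeideal P R" and fin: "finite I"
    and J: "\<And>i. i \<in> I \<Longrightarrow> ideal (J i) R" and not_sub: "\<And>i. i \<in> I \<Longrightarrow> \<not> J i \<subseteq> P"
  shows "\<exists>a\<in>carrier R. a \<notin> P \<and> (\<forall>i\<in>I. a \<in> J i)"
  using fin J not_sub
proof (induction I)
  case empty
  interpret primeideal P R by (rule P)
  show ?case using one_imp_carrier I_notcarr by auto
next
  case (insert k I)
  interpret primeideal P R by (rule P)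
  obtain a where a: "a \<in> carrier R" "a \<notin> P" "\<forall>i\<in>I. a \<in> J i"
    using insert.IH insert.prems by blast
  obtain b where b: "b \<in> J k" "b \<notin> P" using insert.prems(2)[of k] by auto
  have b_carr: "b \<in> carrier R" using ideal.Icarr[OF insert.prems(1)] b(1) by blast
  have "a \<otimes>\<^bsub>R\<^esub> b \<notin> P" using I_prime[OF a(1) b_carr] a(2) b(2) by blast
  moreover have "a \<otimes>\<^bsub>R\<^esub> b \<in> J i" if i: "i \<in> insert k I" for i
  proof (cases "i = k")
    case True
    then show ?thesis using ideal.I_l_closed[OF insert.prems(1)[OF i]] b(1) a(1) by simp
  next
    case False
    then show ?thesis using ideal.I_r_closed[OF insert.prems(1)[OF i]] i a(3) b_carr by simp
  qed
  ultimately show ?case using a(1) b_carr by blast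
qed

text \<open>
  The definition of a second submodule quantifies over all ideals; applied to the principal ideal
  generated by \<open>a\<close>, whose product with \<open>K\<close> is just \<open>a K\<close>, it says that \<open>a\<close> either annihilates
  \<open>K\<close> or acts surjectively on it.
\<close>

lemma (in module) second_smult_image:
  assumes second: "second_submodule R M K" and a: "a \<in> carrier R" "a \<notin> annihilator R M K"
  shows "(\<lambda>x. a \<odot>\<^bsub>M\<^esub> x) ` K = K"
proof
  have sub: "submodule K R M" using second by (simp add: second_submodule_def)
  have K: "K \<subseteq> carrier M" by (rule submoduleE(1)[OF sub])
  show "(\<lambda>x. a \<odot>\<^bsub>M\<^esub> x) ` K \<subseteq> K" using submoduleE(4)[OF sub a(1)] by auto
  let ?I = "PIdl\<^bsub>R\<^esub> a"
  have "ideal_smult M ?I K \<noteq> {\<zero>\<^bsub>M\<^esub>}"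
    using a ideal_smult.smult[OF R.cgenideal_self[OF a(1)], of _ K M]
    by (auto simp: annihilator_def)
  then have eq: "ideal_smult M ?I K = K"
    using second R.cgenideal_ideal[OF a(1)] by (auto simp: second_submodule_def)
  have "y \<in> (\<lambda>x. a \<odot>\<^bsub>M\<^esub> x) ` K" if "y \<in> ideal_smult M ?I K" for y
    using that
  proof induction
    case (smult c x)
    then obtain r where r: "r \<in> carrier R" "c = r \<otimes>\<^bsub>R\<^esub> a" by (auto simp: cgenideal_def)
    have "c \<odot>\<^bsub>M\<^esub> x = a \<odot>\<^bsub>M\<^esub> (r \<odot>\<^bsub>M\<^esub> x)"
      using r a smult K by (auto simp: R.m_comm[of r a] smult_assoc1)
    moreover have "r \<odot>\<^bsub>M\<^esub> x \<in> K" using submoduleE(4)[OF sub r(1)] smult by blast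
    ultimately show ?case by blast
  next
    case (sum x y)
    then obtain u v where uv: "u \<in> K" "v \<in> K" "x = a \<odot>\<^bsub>M\<^esub> u" "y = a \<odot>\<^bsub>M\<^esub> v" by blast
    then have "x \<oplus>\<^bsub>M\<^esub> y = a \<odot>\<^bsub>M\<^esub> (u \<oplus>\<^bsub>M\<^esub> v)"
      using a(1) K by (simp add: smult_r_distr subsetD)
    then show ?case using submoduleE(5)[OF sub uv(1,2)] by blast
  qed
  then show "K \<subseteq> (\<lambda>x. a \<odot>\<^bsub>M\<^esub> x) ` K" using eq by blast
qed

lemma (in module) smult_image_submodule_sum:
  assumes fin: "finite I" and j: "j \<in> I" and a: "a \<in> carrier R"
    and sub: "\<And>i. i \<in> I \<Longrightarrow> submodule (K i) R M"
    and ann: "\<And>i. i \<in> I - {j} \<Longrightarrow> a \<in> annihilator R M (K i)"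
    and M: "carrier M = submodule_sum M I K"
  shows "(\<lambda>x. a \<odot>\<^bsub>M\<^esub> x) ` carrier M = (\<lambda>x. a \<odot>\<^bsub>M\<^esub> x) ` K j"
proof
  have K: "K i \<subseteq> carrier M" if "i \<in> I" for i by (rule submoduleE(1)[OF sub[OF that]])
  show "(\<lambda>x. a \<odot>\<^bsub>M\<^esub> x) ` K j \<subseteq> (\<lambda>x. a \<odot>\<^bsub>M\<^esub> x) ` carrier M" using K[OF j] by blast
  have "a \<odot>\<^bsub>M\<^esub> y \<in> (\<lambda>x. a \<odot>\<^bsub>M\<^esub> x) ` K j" if "y \<in> carrier M" for y
  proof -
    obtain x where x: "x \<in> (\<Pi> i\<in>I. K i)" "y = (\<Oplus>\<^bsub>M\<^esub>i\<in>I. x i)"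
      using \<open>y \<in> carrier M\<close> unfolding M submodule_sum_def by blast
    have xK: "x i \<in> K i" if "i \<in> I" for i using x(1) that by auto
    then have xM: "x i \<in> carrier M" if "i \<in> I" for i using that K by blast
    have "(\<Oplus>\<^bsub>M\<^esub>i\<in>insert j (I - {j}). x i) = x j \<oplus>\<^bsub>M\<^esub> (\<Oplus>\<^bsub>M\<^esub>i\<in>I - {j}. x i)"
      using fin j xM by (intro M.finsum_insert) auto
    then have y: "y = x j \<oplus>\<^bsub>M\<^esub> (\<Oplus>\<^bsub>M\<^esub>i\<in>I - {j}. x i)"
      using x(2) j by (simp add: insert_absorb)
    have "a \<odot>\<^bsub>M\<^esub> (\<Oplus>\<^bsub>M\<^esub>i\<in>I - {j}. x i) = (\<Oplus>\<^bsub>M\<^esub>i\<in>I - {j}. a \<odot>\<^bsub>M\<^esub> x i)"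
      using fin a xM by (intro finsum_smult_ldistr) auto
    also have "\<dots> = \<zero>\<^bsub>M\<^esub>"
      using ann xK by (intro M.add.finprod_one_eqI) (auto simp: annihilator_def)
    finally have "a \<odot>\<^bsub>M\<^esub> y = a \<odot>\<^bsub>M\<^esub> x j"
      using y a j xM by (auto simp: smult_r_distr)
    then show ?thesis using xK[OF j] by blast
  qed
  then show "(\<lambda>x. a \<odot>\<^bsub>M\<^esub> x) ` carrier M \<subseteq> (\<lambda>x. a \<odot>\<^bsub>M\<^esub> x) ` K j" by blast
qed

text \<open>
  The hypotheses on \<open>a\<close> involve the summands only through their annihilators, and the right-hand side
  does not involve them at all; two representations with the same primes can thus share one \<open>a\<close>.
\<close>

lemma (in module) second_summand_eq_smult_image:
  assumes rep: "second_representation R M n K" and j: "j \<in> {1..n}" and a: "a \<in> carrier R"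
    and not_ann: "a \<notin> annihilator R M (K j)"
    and ann: "\<And>i. i \<in> {1..n} - {j} \<Longrightarrow> a \<in> annihilator R M (K i)"
  shows "K j = (\<lambda>x. a \<odot>\<^bsub>M\<^esub> x) ` carrier M"
proof -
  have second: "second_submodule R M (K i)" if "i \<in> {1..n}" for i
    using rep that by (auto simp: second_representation_def)
  have "(\<lambda>x. a \<odot>\<^bsub>M\<^esub> x) ` carrier M = (\<lambda>x. a \<odot>\<^bsub>M\<^esub> x) ` K j"
  proof (rule smult_image_submodule_sum[OF finite_atLeastAtMost j a])
    show "submodule (K i) R M" if "i \<in> {1..n}" for i
      using second[OF that] by (simp add: second_submodule_def)
    show "carrier M = submodule_sum M {1..n} K"
      using rep by (simp add: second_representation_def)
  qed (rule ann)
  also have "\<dots> = K j" by (rule second_smult_image[OF second[OF j] a not_ann])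
  finally show ?thesis by simp
qed

theorem theorem2p10:
  fixes R :: "('b, 'r) ring_scheme"
    and M :: "('b, 'a, 'm) module_scheme"
    and n j :: nat
    and K N :: "nat \<Rightarrow> 'a set"
    and p :: "nat \<Rightarrow> 'b set"
  assumes "module R M"
    and "carrier M \<noteq> {\<zero>\<^bsub>M\<^esub>}"
    and "second_representable R M"
    and "minimal_second_representation R M n K"
    and "minimal_second_representation R M n N"
    and "\<And>i. i \<in> {1..n} \<Longrightarrow> p_second R M (p i) (K i)"
    and "\<And>i. i \<in> {1..n} \<Longrightarrow> p_second R M (p i) (N i)"
    and "j \<in> {1..n}"
    and "\<And>i. i \<in> {1..n} \<Longrightarrow> p i \<subseteq> p j \<Longrightarrow> p i = p j"
  shows "K j = N j"
proof -
  interpret module R M by fact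
  have K: "second_submodule R M (K i)" "p i = annihilator R M (K i)" if "i \<in> {1..n}" for i
    using assms(6)[OF that] by (simp_all add: p_second_def)
  have N: "p i = annihilator R M (N i)" if "i \<in> {1..n}" for i
    using assms(7)[OF that] by (simp add: p_second_def)
  have prime: "primeideal (p i) R" if "i \<in> {1..n}" for i
    using second_imp_primeideal[OF K(1)[OF that]] K(2)[OF that] by simp
  have not_sub: "\<not> p i \<subseteq> p j" if "i \<in> {1..n} - {j}" for i
  proof
    assume "p i \<subseteq> p j"
    then have "p i = p j" using assms(9) that by blast
    then show False
      using assms(4,8) K(2) that by (auto simp: minimal_second_representation_def)
  qed
  have "\<exists>a\<in>carrier R. a \<notin> p j \<and> (\<forall>i\<in>{1..n} - {j}. a \<in> p i)"
    by (rule exists_in_ideals_notin_prime[OF prime[OF assms(8)]])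
      (use not_sub in \<open>auto intro: primeideal.axioms(1)[OF prime]\<close>)
  then obtain a where a: "a \<in> carrier R" "a \<notin> p j" "\<And>i. i \<in> {1..n} - {j} \<Longrightarrow> a \<in> p i"
    by blast
  have "K j = (\<lambda>x. a \<odot>\<^bsub>M\<^esub> x) ` carrier M"
    by (rule second_summand_eq_smult_image[OF _ assms(8) a(1)])
      (use assms(4,8) a K(2) in \<open>auto simp: minimal_second_representation_def\<close>)
  moreover have "N j = (\<lambda>x. a \<odot>\<^bsub>M\<^esub> x) ` carrier M"
    by (rule second_summand_eq_smult_image[OF _ assms(8) a(1)])
      (use assms(5,8) a N in \<open>auto simp: minimal_second_representation_def\<close>)
  ultimately show ?thesis by simp
qed

end
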